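(* Let $\mathcal{A}$ and $\mathcal{B}$ be 2-torsion free semiprime associative rings (not assumed unital), and let $\mathcal{M}$ be a 2-torsion free faithful $(\mathcal{A},\mathcal{B})$-bimodule such that $\{m\in\mathcal{M} : \mathcal{A}m=\{0\}\}=\{0\}$ and $\{m\in\mathcal{M} : m\mathcal{B}=\{0\}\}=\{0\}$. Let $\mathfrak{T}=Tri(\mathcal{A},\mathcal{M},\mathcal{B})$ be the associated triangular ring. Then every Jordan centralizer $\Psi:\mathfrak{T}\to\mathfrak{T}$ is a (two-sided) centralizer.
   Context: Rings are associative and need not have a unity; modules are not assumed unital. An $(\mathcal{A},\mathcal{B})$-bimodule $\mathcal{M}$ is faithful if it is faithful as a left $\mathcal{A}$-module ($a\mathcal{M}=\{0\}$ implies $a=0$) and as a right $\mathcal{B}$-module ($\mathcal{M}b=\{0\}$ implies $b=0$). The triangular ring $Tri(\mathcal{A},\mathcal{M},\mathcal{B})$ is the set of all matrices $\begin{bmatrix} a & m\\ 0 & b\end{bmatrix}$ with $a\in\mathcal{A}$, $m\in\mathcal{M}$, $b\in\mathcal{B}$, under the usual matrix operations. A ring or module $R$ is 2-torsion free if $2x=0$ implies $x=0$. A ring $\mathcal{R}$ is semiprime if $x\mathcal{R}x=\{0\}$ implies $x=0$. Write $x\circ y=xy+yx$. An additive map $T:\mathcal{R}\to\mathcal{R}$ is a Jordan centralizer if $T(x\circ y)=T(x)\circ y=x\circ T(y)$ for all $x,y\in\mathcal{R}$. It is a (two-sided) centralizer if $T(xy)=T(x)y=xT(y)$ for all $x,y\in\mathcal{R}$.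 *)

theory Defs
  imports Complex_Main "HOL-Library.Product_Plus"
begin

text \<open>
  Rings are types of class \<open>ring\<close> (associative, no unity required); the module is a type of
  class \<open>ab_group_add\<close>. No unital law is imposed on the two actions.
\<close>

locale bimodule =
  fixes lact :: "'a::ring \<Rightarrow> 'm::ab_group_add \<Rightarrow> 'm" (infixr "\<rhd>" 75)
    and ract :: "'m \<Rightarrow> 'b::ring \<Rightarrow> 'm" (infixl "\<lhd>" 75)
  assumes lact_add_left: "(a + a') \<rhd> m = a \<rhd> m + a' \<rhd> m"
    and lact_add_right: "a \<rhd> (m + m') = a \<rhd> m + a \<rhd> m'"
    and lact_mult: "(a * a') \<rhd> m = a \<rhd> (a' \<rhd> m)"
    and ract_add_left: "(m + m') \<lhd> b = m \<lhd> b + m' \<lhd> b"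
    and ract_add_right: "m \<lhd> (b + b') = m \<lhd> b + m \<lhd> b'"
    and ract_mult: "m \<lhd> (b * b') = (m \<lhd> b) \<lhd> b'"
    and lact_ract: "(a \<rhd> m) \<lhd> b = a \<rhd> (m \<lhd> b)"

locale faithful_bimodule = bimodule +
  assumes faithful_left: "(\<forall>m. a \<rhd> m = 0) \<Longrightarrow> a = 0"
    and faithful_right: "(\<forall>m. m \<lhd> b = 0) \<Longrightarrow> b = 0"

definition two_torsion_free :: "'a::ab_group_add itself \<Rightarrow> bool" where
  "two_torsion_free _ \<longleftrightarrow> (\<forall>x::'a. x + x = 0 \<longrightarrow> x = 0)"

definition semiprime_ring :: "'a::ring itself \<Rightarrow> bool" where
  "semiprime_ring _ \<longleftrightarrow> (\<forall>x::'a. (\<forall>y. x * y * x = 0) \<longrightarrow> x = 0)"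

text \<open>
  The triple \<open>(a, m, b)\<close> stands for the upper triangular matrix with diagonal entries
  \<open>a\<close>, \<open>b\<close> and upper right entry \<open>m\<close>. Matrix addition is the componentwise addition
  of the product type; the matrix multiplication depends on the two actions, so it is an
  explicit function instead of a type class operation.
\<close>

type_synonym ('a, 'm, 'b) tri = "'a \<times> 'm \<times> 'b"

fun tri_mult ::
  "('a::ring \<Rightarrow> 'm::ab_group_add \<Rightarrow> 'm) \<Rightarrow> ('m \<Rightarrow> 'b::ring \<Rightarrow> 'm) \<Rightarrow>
    ('a, 'm, 'b) tri \<Rightarrow> ('a, 'm, 'b) tri \<Rightarrow> ('a, 'm, 'b) tri" where
  "tri_mult lact ract (a, m, b) (a', m', b') = (a * a', lact a m' + ract m b', b * b')"

text \<open>Together with componentwise addition, \<open>tri_mult\<close> makes the triples a ring.\<close>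

context bimodule
begin

lemma tri_mult_assoc:
  "tri_mult lact ract (tri_mult lact ract x y) z = tri_mult lact ract x (tri_mult lact ract y z)"
  by (cases x; cases y; cases z)
    (simp add: mult.assoc lact_mult ract_mult lact_ract lact_add_right ract_add_left add.assoc)

lemma tri_mult_add_left:
  "tri_mult lact ract (x + y) z = tri_mult lact ract x z + tri_mult lact ract y z"
  by (cases x; cases y; cases z)
    (simp add: distrib_right lact_add_left ract_add_left add_ac)

lemma tri_mult_add_right:
  "tri_mult lact ract x (y + z) = tri_mult lact ract x y + tri_mult lact ract x z"
  by (cases x; cases y; cases z)
    (simp add: distrib_left lact_add_right ract_add_right add_ac)

end

text \<open>
  In the following notions \<open>mult\<close> is the multiplication of the ring whose additive group is
  the type \<open>'r\<close>.
\<close>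

definition jordan_product :: "('r::ab_group_add \<Rightarrow> 'r \<Rightarrow> 'r) \<Rightarrow> 'r \<Rightarrow> 'r \<Rightarrow> 'r" where
  "jordan_product mult x y = mult x y + mult y x"

definition jordan_centralizer :: "('r::ab_group_add \<Rightarrow> 'r \<Rightarrow> 'r) \<Rightarrow> ('r \<Rightarrow> 'r) \<Rightarrow> bool" where
  "jordan_centralizer mult T \<longleftrightarrow>
    Modules.additive T \<and>
    (\<forall>x y. T (jordan_product mult x y) = jordan_product mult (T x) y \<and>
           T (jordan_product mult x y) = jordan_product mult x (T y))"

definition centralizer :: "('r::ab_group_add \<Rightarrow> 'r \<Rightarrow> 'r) \<Rightarrow> ('r \<Rightarrow> 'r) \<Rightarrow> bool" where
  "centralizer mult T \<longleftrightarrow>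
    Modules.additive T \<and>
    (\<forall>x y. T (mult x y) = mult (T x) y \<and> T (mult x y) = mult x (T y))"

end

theory Submission
  imports Defs
begin

text \<open>
  The triangular ring is in general not semiprime, but it has three properties that replace
  semiprimeness: it is 2-torsion free, its centre contains no nonzero element of square zero, and
  no nonzero element \<open>r\<close> satisfies \<open>r w = 0\<close> for all \<open>w\<close>. In any ring with these properties a
  Jordan centralizer \<open>T\<close> is a centralizer, for the following reason.

  The double commutator \<open>[y, [x, z]]\<close> is the Jordan associator
  \<open>(x \<circ> y) \<circ> z - x \<circ> (y \<circ> z)\<close>. Therefore \<open>T\<close> can be moved onto either of \<open>x\<close> and \<open>z\<close>,
  and \<open>[y, [T x, z]] = [y, [x, T z]]\<close> holds for every \<open>y\<close>. At \<open>z = x\<close> this says that twice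
  \<open>c = [T x, x]\<close> is central, so \<open>c\<close> is. The same fact at \<open>x\<^sup>2\<close>, where
  \<open>2 T (x\<^sup>2) = T x \<circ> x\<close>, says that \<open>c x\<^sup>2\<close> is central, and two further commutators with
  \<open>T x\<close> give \<open>c\<^sup>3 = 0\<close>. The centre being reduced, \<open>T x\<close> commutes with \<open>x\<close>. Linearizing,
  \<open>[T x, z] = [x, T z]\<close>; added to \<open>T x \<circ> z = x \<circ> T z\<close> this is the balance law
  \<open>T x z = x T z\<close>. Finally \<open>T (x z) w = x z T w = x T z w = T x z w\<close> for all \<open>w\<close>, and \<open>w\<close>
  can be cancelled because the left annihilator is trivial.

  In the triangular ring, the diagonal of a central square-zero element is central and square-zero
  in the semiprime rings \<open>A\<close> and \<open>B\<close>, hence zero; the corner is then killed by the action of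
  \<open>A\<close>, hence zero too. If \<open>(a, m, b)\<close> annihilates the triangular ring from the left, then
  \<open>a A\<close> and \<open>b B\<close> vanish, so \<open>a\<close> and \<open>b\<close> do by semiprimeness, and \<open>m = 0\<close> because \<open>m B\<close>
  vanishes.
\<close>

section \<open>Associative multiplications on an abelian group\<close>

text \<open>
  The product of a triangular ring depends on the two actions and so is a parameter here rather
  than a type class operation.
\<close>

locale ring_multiplication =
  fixes mult :: "'r::ab_group_add \<Rightarrow> 'r \<Rightarrow> 'r" (infixl "\<cdot>" 70)
  assumes assoc: "(x \<cdot> y) \<cdot> z = x \<cdot> (y \<cdot> z)"
    and add_left: "(x + y) \<cdot> z = x \<cdot> z + y \<cdot> z"
    and add_right: "x \<cdot> (y + z) = x \<cdot> y + x \<cdot> z"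
begin

lemma zero_left [simp]: "0 \<cdot> x = 0"
  using add_left[of 0 0 x] by simp

lemma zero_right [simp]: "x \<cdot> 0 = 0"
  using add_right[of x 0 0] by simp

lemma diff_left: "(x - y) \<cdot> z = x \<cdot> z - y \<cdot> z"
  using add_left[of "x - y" y z] by (simp add: algebra_simps)

lemma diff_right: "x \<cdot> (y - z) = x \<cdot> y - x \<cdot> z"
  using add_right[of x "y - z" z] by (simp add: algebra_simps)

lemmas expand = add_left add_right diff_left diff_right assoc

abbreviation jordan (infixl "\<bullet>" 70) where
  "x \<bullet> y \<equiv> jordan_product mult x y"

definition commutator :: "'r \<Rightarrow> 'r \<Rightarrow> 'r" where
  "commutator x y = x \<cdot> y - y \<cdot> x"

definition central :: "'r \<Rightarrow> bool" where
  "central c \<longleftrightarrow> (\<forall>y. c \<cdot> y = y \<cdot> c)"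

definition reduced_centre :: bool where
  "reduced_centre \<longleftrightarrow> (\<forall>c. central c \<longrightarrow> c \<cdot> c = 0 \<longrightarrow> c = 0)"

definition trivial_left_annihilator :: bool where
  "trivial_left_annihilator \<longleftrightarrow> (\<forall>r. (\<forall>w. r \<cdot> w = 0) \<longrightarrow> r = 0)"

lemma central_iff_commutator: "central c \<longleftrightarrow> (\<forall>y. commutator y c = 0)"
  by (auto simp: central_def commutator_def)

lemma central_mult: "central c \<Longrightarrow> central d \<Longrightarrow> central (c \<cdot> d)"
  unfolding central_def by (metis assoc)

lemma commutator_diff_right: "commutator x (y - z) = commutator x y - commutator x z"
  by (simp add: commutator_def expand algebra_simps)

lemma commutator_add_right: "commutator x (y + z) = commutator x y + commutator x z"
  by (simp add: commutator_def expand algebra_simps)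

lemma commutator_commutator_eq_jordan_associator:
  "commutator y (commutator x z) = (x \<bullet> y) \<bullet> z - x \<bullet> (y \<bullet> z)"
  by (simp add: commutator_def jordan_product_def expand algebra_simps)

lemma central_halve:
  assumes "two_torsion_free TYPE('r)" and "central (c + c)"
  shows "central c"
  using assms unfolding central_iff_commutator commutator_add_right two_torsion_free_def by blast

lemma reduced_centre_cube:
  assumes "reduced_centre" and "central c" and cube: "c \<cdot> c \<cdot> c = 0"
  shows "c = 0"
proof -
  have "(c \<cdot> c) \<cdot> (c \<cdot> c) = (c \<cdot> c \<cdot> c) \<cdot> c"
    by (simp add: assoc)
  then have "c \<cdot> c = 0"
    using assms central_mult[of c c] unfolding reduced_centre_def by simp
  then show ?thesis
    using assms by (simp add: reduced_centre_def)
qed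

text \<open>
  The commutator \<open>c\<close> of \<open>t\<close> and \<open>x\<close> being central, \<open>[t, \<cdot>]\<close> acts on the powers of \<open>x\<close> as \<open>c\<close> times
  the derivative. Two derivatives turn the central element \<open>c x\<^sup>2\<close> into \<open>2 c\<^sup>3\<close>, while the
  first of them already annihilates it.
\<close>

lemma central_commutator_cube:
  assumes tf: "two_torsion_free TYPE('r)"
    and c: "central c" "commutator t x = c"
    and square: "central (c \<cdot> (x \<cdot> x))"
  shows "c \<cdot> c \<cdot> c = 0"
proof -
  have tx: "t \<cdot> x = x \<cdot> t + c"
    using c(2) by (auto simp: commutator_def algebra_simps)
  have cc: "y \<cdot> c = c \<cdot> y" for y
    using c(1) by (simp add: central_def)
  have deriv: "t \<cdot> (c \<cdot> (x \<cdot> x)) = c \<cdot> (x \<cdot> x) \<cdot> t + (c \<cdot> c \<cdot> x + c \<cdot> c \<cdot> x)"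
  proof -
    have "t \<cdot> (c \<cdot> (x \<cdot> x)) = c \<cdot> ((t \<cdot> x) \<cdot> x)"
      by (metis assoc cc)
    also have "\<dots> = c \<cdot> (x \<cdot> (t \<cdot> x) + c \<cdot> x)"
      by (simp add: tx expand)
    also have "\<dots> = c \<cdot> (x \<cdot> x) \<cdot> t + (c \<cdot> c \<cdot> x + c \<cdot> c \<cdot> x)"
      by (simp add: tx expand cc[of x])
    finally show ?thesis .
  qed
  have "t \<cdot> (c \<cdot> (x \<cdot> x)) = c \<cdot> (x \<cdot> x) \<cdot> t"
    using square by (simp add: central_def)
  with deriv have "c \<cdot> c \<cdot> x + c \<cdot> c \<cdot> x = 0"
    by (metis add_cancel_right_right)
  then have zero: "c \<cdot> c \<cdot> x = 0"
    using tf unfolding two_torsion_free_def by blast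
  have "c \<cdot> c \<cdot> c = c \<cdot> c \<cdot> (t \<cdot> x) - c \<cdot> c \<cdot> x \<cdot> t"
    by (simp add: tx expand)
  also have "c \<cdot> c \<cdot> (t \<cdot> x) = t \<cdot> (c \<cdot> c \<cdot> x)"
    by (metis assoc cc)
  finally show ?thesis
    using zero by simp
qed

end

section \<open>Jordan centralizers of rings with reduced centre\<close>

locale jordan_centralizer_on_ring = ring_multiplication +
  fixes T :: "'a \<Rightarrow> 'a"
  assumes jordan_centralizer: "jordan_centralizer mult T"
begin

lemma T_add: "T (x + y) = T x + T y"
  using jordan_centralizer unfolding jordan_centralizer_def Modules.additive_def by blast

lemma T_diff: "T (x - y) = T x - T y"
  using T_add[of "x - y" y] by (simp add: algebra_simps)

lemma T_jordan_left: "T (x \<bullet> y) = T x \<bullet> y"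
  and T_jordan_right: "T (x \<bullet> y) = x \<bullet> T y"
  using jordan_centralizer unfolding jordan_centralizer_def by blast+

text \<open>
  The double commutator is a Jordan associator, and \<open>T\<close> passes through both of its Jordan
  products to whichever of \<open>x\<close> and \<open>z\<close> is chosen.
\<close>

lemma T_commutator_left: "T (commutator y (commutator x z)) = commutator y (commutator (T x) z)"
  unfolding commutator_commutator_eq_jordan_associator
  by (metis T_diff T_jordan_left)

lemma T_commutator_right: "T (commutator y (commutator x z)) = commutator y (commutator x (T z))"
  unfolding commutator_commutator_eq_jordan_associator
  by (metis T_diff T_jordan_right)

lemma central_commutator_T:
  assumes "two_torsion_free TYPE('a)"
  shows "central (commutator (T x) x)"
proof -
  have "commutator (T x) x - commutator x (T x) = commutator (T x) x + commutator (T x) x"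
    by (simp add: commutator_def)
  moreover have "central (commutator (T x) x - commutator x (T x))"
    unfolding central_iff_commutator commutator_diff_right
    by (metis T_commutator_left T_commutator_right diff_self)
  ultimately show ?thesis
    using central_halve assms by metis
qed

text \<open>
  With \<open>c = [T x, x]\<close> central, \<open>2 T (x\<^sup>2) = T x \<circ> x\<close> yields \<open>2 [T (x\<^sup>2), x\<^sup>2] = 4 c x\<^sup>2\<close>, and the
  left hand side is central because \<open>[T y, y]\<close> is so for \<open>y = x\<^sup>2\<close>.
\<close>

lemma central_commutator_T_square:
  assumes tf: "two_torsion_free TYPE('a)"
  shows "central (commutator (T x) x \<cdot> (x \<cdot> x))"
proof -
  define c where "c = commutator (T x) x"
  have tx: "T x \<cdot> x = x \<cdot> T x + c"
    by (simp add: c_def commutator_def)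
  have cc: "y \<cdot> c = c \<cdot> y" for y
    using central_commutator_T[OF tf, of x] by (simp add: central_def c_def)
  define s where "s = commutator (T (x \<cdot> x)) (x \<cdot> x)"
  have "T (x \<cdot> x) + T (x \<cdot> x) = T x \<cdot> x + x \<cdot> T x"
    using T_jordan_left[of x x] by (simp add: jordan_product_def T_add)
  then have double: "s + s = (T x \<cdot> x + x \<cdot> T x) \<cdot> (x \<cdot> x) - (x \<cdot> x) \<cdot> (T x \<cdot> x + x \<cdot> T x)"
    unfolding s_def commutator_def
    by (metis (no_types, lifting) add_left add_right add_diff_add)
  have deriv: "T x \<cdot> (x \<cdot> x) = x \<cdot> x \<cdot> T x + (c \<cdot> x + c \<cdot> x)"
  proof -
    have "T x \<cdot> (x \<cdot> x) = (x \<cdot> T x + c) \<cdot> x"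
      by (simp flip: assoc add: tx)
    also have "\<dots> = x \<cdot> (T x \<cdot> x) + c \<cdot> x"
      by (simp add: expand)
    also have "\<dots> = x \<cdot> x \<cdot> T x + (c \<cdot> x + c \<cdot> x)"
      by (simp add: tx expand cc[of x])
    finally show ?thesis .
  qed
  let ?q = "c \<cdot> (x \<cdot> x)"
  have left: "T x \<cdot> x \<cdot> (x \<cdot> x) = x \<cdot> x \<cdot> (T x \<cdot> x) + (?q + ?q)"
  proof -
    have "T x \<cdot> x \<cdot> (x \<cdot> x) = (T x \<cdot> (x \<cdot> x)) \<cdot> x"
      by (simp add: assoc)
    then show ?thesis
      by (simp only: deriv) (simp add: expand)
  qed
  have right: "x \<cdot> T x \<cdot> (x \<cdot> x) = x \<cdot> x \<cdot> (x \<cdot> T x) + (?q + ?q)"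
  proof -
    have "x \<cdot> (c \<cdot> x) = ?q"
      by (metis assoc cc)
    moreover have "x \<cdot> T x \<cdot> (x \<cdot> x) = x \<cdot> (T x \<cdot> (x \<cdot> x))"
      by (simp add: assoc)
    ultimately show ?thesis
      by (simp only: deriv) (simp add: expand)
  qed
  have "s + s = (?q + ?q) + (?q + ?q)"
    using double left right by (simp add: add_left add_right)
  moreover have "central s"
    unfolding s_def by (rule central_commutator_T[OF tf])
  then have "central (s + s)"
    by (simp add: central_def expand)
  ultimately show ?thesis
    using central_halve[OF tf] by (metis c_def)
qed

lemma commutator_T_self:
  assumes "two_torsion_free TYPE('a)" and "reduced_centre"
  shows "commutator (T x) x = 0"
  using reduced_centre_cube[OF assms(2) central_commutator_T[OF assms(1)]]
    central_commutator_cube[OF assms(1) central_commutator_T[OF assms(1)] refl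
      central_commutator_T_square[OF assms(1)]]
  by blast

text \<open>
  Linearizing the previous lemma gives \<open>[T x, z] = [x, T z]\<close>. Since also \<open>T x \<circ> z = x \<circ> T z\<close>,
  addition leaves \<open>2 T x z = 2 x T z\<close>.
\<close>

lemma T_balanced:
  assumes tf: "two_torsion_free TYPE('a)" and "reduced_centre"
  shows "T x \<cdot> z = x \<cdot> T z"
proof -
  have "commutator (T (x + z)) (x + z) = 0" "commutator (T x) x = 0" "commutator (T z) z = 0"
    using assms commutator_T_self by blast+
  then have "T x \<cdot> z - z \<cdot> T x = x \<cdot> T z - T z \<cdot> x"
    by (simp add: commutator_def T_add expand algebra_simps)
  moreover have "T x \<cdot> z + z \<cdot> T x = x \<cdot> T z + T z \<cdot> x"
    using T_jordan_left[of x z] T_jordan_right[of x z] by (simp add: jordan_product_def)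
  ultimately have "(T x \<cdot> z - z \<cdot> T x) + (T x \<cdot> z + z \<cdot> T x)
      = (x \<cdot> T z - T z \<cdot> x) + (x \<cdot> T z + T z \<cdot> x)"
    by simp
  then have "(T x \<cdot> z - x \<cdot> T z) + (T x \<cdot> z - x \<cdot> T z) = 0"
    by (simp add: algebra_simps)
  then have "T x \<cdot> z - x \<cdot> T z = 0"
    using tf unfolding two_torsion_free_def by blast
  then show ?thesis
    by simp
qed

theorem centralizer_if_reduced_centre:
  assumes "two_torsion_free TYPE('a)" and "reduced_centre" and "trivial_left_annihilator"
  shows "centralizer mult T"
proof -
  note bal = T_balanced[OF assms(1,2)]
  have "(T (x \<cdot> z) - T x \<cdot> z) \<cdot> w = 0" for x z w
  proof -
    have "T (x \<cdot> z) \<cdot> w = x \<cdot> (z \<cdot> T w)"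
      by (simp only: bal[of "x \<cdot> z" w] assoc)
    also have "\<dots> = x \<cdot> T z \<cdot> w"
      by (simp only: bal[of z w] assoc)
    also have "\<dots> = T x \<cdot> z \<cdot> w"
      by (simp only: bal[of x z])
    finally show ?thesis
      by (simp only: diff_left diff_self)
  qed
  then have "T (x \<cdot> z) - T x \<cdot> z = 0" for x z
    using assms(3) unfolding trivial_left_annihilator_def by blast
  then have left: "T (x \<cdot> z) = T x \<cdot> z" for x z
    using eq_iff_diff_eq_0 by blast
  have "Modules.additive T"
    using jordan_centralizer by (simp only: jordan_centralizer_def)
  then show ?thesis
    using left bal by (metis centralizer_def)
qed

end

section \<open>The triangular ring\<close>

context bimodule
begin

sublocale tri: ring_multiplication "tri_mult lact ract"
  by standard (rule tri_mult_assoc tri_mult_add_left tri_mult_add_right)+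

sublocale lact: Modules.additive "\<lambda>m. lact a m" for a
  by standard (rule lact_add_right)

lemma lact_zero_left [simp]: "lact 0 m = 0"
  using lact_add_left[of 0 0 m] by simp

lemma ract_zero_right [simp]: "ract m 0 = 0"
  using ract_add_right[of m 0 0] by simp

lemma tri_two_torsion_free:
  assumes "two_torsion_free TYPE('a)" "two_torsion_free TYPE('m)" "two_torsion_free TYPE('b)"
  shows "two_torsion_free TYPE('a \<times> 'm \<times> 'b)"
  unfolding two_torsion_free_def
proof (intro allI impI)
  fix x :: "'a \<times> 'm \<times> 'b"
  assume double: "x + x = 0"
  obtain a m b where x: "x = (a, m, b)"
    by (cases x)
  have "a + a = 0" "m + m = 0" "b + b = 0"
    using double by (simp_all add: x zero_prod_def)
  then have "a = 0" "m = 0" "b = 0"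
    using assms unfolding two_torsion_free_def by blast+
  then show "x = 0"
    by (simp add: x zero_prod_def)
qed

end

lemma semiprime_central_square_zero:
  assumes "semiprime_ring TYPE('a::ring)"
    and "\<And>y. (c::'a) * y = y * c" and "c * c = 0"
  shows "c = 0"
proof -
  have "c * y * c = 0" for y
    by (metis assms(2,3) mult.assoc mult_zero_right)
  then show ?thesis
    using assms(1) unfolding semiprime_ring_def by blast
qed

lemma semiprime_left_annihilator:
  assumes "semiprime_ring TYPE('a::ring)"
    and "\<And>w. (r::'a) * w = 0"
  shows "r = 0"
proof -
  have "r * y * r = 0" for y
    using assms(2) by simp
  then show ?thesis
    using assms(1) unfolding semiprime_ring_def by blast
qed

context bimodule
begin

text \<open>
  An element commuting with all \<open>(y, 0, 0)\<close> and \<open>(0, 0, z)\<close> has central diagonal entries. Once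
  these vanish, commuting with \<open>(y, 0, 0)\<close> forces the corner to be annihilated by \<open>A\<close>.
\<close>

lemma tri_reduced_centre:
  assumes sa: "semiprime_ring TYPE('a)" and sb: "semiprime_ring TYPE('b)"
    and ann: "\<And>m. \<forall>a. lact a m = 0 \<Longrightarrow> m = 0"
  shows "tri.reduced_centre"
  unfolding tri.reduced_centre_def
proof (intro allI impI)
  fix c assume cen: "tri.central c" and sq: "tri_mult lact ract c c = 0"
  obtain a m b where c: "c = (a, m, b)"
    by (cases c)
  have comm: "tri_mult lact ract c y = tri_mult lact ract y c" for y
    using cen unfolding tri.central_def by blast
  have "a = 0"
  proof (rule semiprime_central_square_zero[OF sa])
    show "a * y = y * a" for y
      using comm[of "(y, 0, 0)"] by (simp add: c)
    show "a * a = 0"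
      using sq by (simp add: c zero_prod_def)
  qed
  moreover have "b = 0"
  proof (rule semiprime_central_square_zero[OF sb])
    show "b * y = y * b" for y
      using comm[of "(0, 0, y)"] by (simp add: c)
    show "b * b = 0"
      using sq by (simp add: c zero_prod_def)
  qed
  moreover have "lact y m = 0" for y
    using comm[of "(y, 0, 0)"] \<open>a = 0\<close> \<open>b = 0\<close> by (simp add: c lact.zero)
  then have "m = 0"
    using ann by blast
  ultimately show "c = 0"
    by (simp add: c zero_prod_def)
qed

lemma tri_trivial_left_annihilator:
  assumes sa: "semiprime_ring TYPE('a)" and sb: "semiprime_ring TYPE('b)"
    and ann: "\<And>m. \<forall>b. ract m b = 0 \<Longrightarrow> m = 0"
  shows "tri.trivial_left_annihilator"
  unfolding tri.trivial_left_annihilator_def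
proof (intro allI impI)
  fix r assume r0: "\<forall>w. tri_mult lact ract r w = 0"
  obtain a m b where r: "r = (a, m, b)"
    by (cases r)
  have entries: "a * a' = 0" "lact a m' + ract m b' = 0" "b * b' = 0" for a' m' b'
    using r0[rule_format, of "(a', m', b')"] by (simp_all add: r zero_prod_def)
  have "a = 0" "b = 0"
    using entries(1,3) semiprime_left_annihilator[OF sa] semiprime_left_annihilator[OF sb] by blast+
  moreover have "m = 0"
    using entries(2)[of 0] \<open>a = 0\<close> ann by simp
  ultimately show "r = 0"
    by (simp add: r zero_prod_def)
qed

end

theorem theorem2p10:
  fixes lact :: "'a::ring \<Rightarrow> 'm::ab_group_add \<Rightarrow> 'm"
    and ract :: "'m \<Rightarrow> 'b::ring \<Rightarrow> 'm"
    and \<Psi> :: "('a, 'm, 'b) tri \<Rightarrow> ('a, 'm, 'b) tri"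
  assumes "two_torsion_free TYPE('a)" and "semiprime_ring TYPE('a)"
    and "two_torsion_free TYPE('b)" and "semiprime_ring TYPE('b)"
    and "faithful_bimodule lact ract" and "two_torsion_free TYPE('m)"
    and "{m. \<forall>a. lact a m = 0} = {0}"
    and "{m. \<forall>b. ract m b = 0} = {0}"
    and "jordan_centralizer (tri_mult lact ract) \<Psi>"
  shows "centralizer (tri_mult lact ract) \<Psi>"
proof -
  interpret bimodule lact ract
    using assms(5) by (rule faithful_bimodule.axioms(1))
  interpret jordan_centralizer_on_ring "tri_mult lact ract" \<Psi>
    by standard (rule assms(9))
  have annl: "m = 0" if "\<forall>a. lact a m = 0" for m
    using assms(7) that by blast
  have annr: "m = 0" if "\<forall>b. ract m b = 0" for m
    using assms(8) that by blast
  show ?thesis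
    by (rule centralizer_if_reduced_centre
        [OF tri_two_torsion_free[OF assms(1,6,3)] tri_reduced_centre[OF assms(2,4) annl]
          tri_trivial_left_annihilator[OF assms(2,4) annr]])
qed

end
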